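(* Let $G=(V,E)$ be a connected graph, $a^{\mathsf T}x\le b$ facet-defining for $\textsc{Bond}(G)$, and $P$ an induced path in $G$. Let $\mathcal{E}$ be the set of all bonds $\delta$ of $G$ with $a^{\mathsf T}x^\delta=b$. Assume that $\{x:a^{\mathsf T}x\le b\}\neq\{x:-x_e\le 0\}$ for each $e\in E(P)$, and that either there exist $e,f\in E(P)$ with $a_e\neq a_f$ or there is no $\delta\in\mathcal{E}$ with $|\delta\cap E(P)|=2$. Let $\bar G=(\bar V,\bar E)$ be obtained from $G$ by replacing $P$ by a single edge $p$ (joining the end vertices of $P$). Set $M=\max_{e\in E(P)}a_e$ and define $\bar a\in\mathbb{R}^{\bar E}$ by $\bar a_e=a_e$ for $e\in \bar E\cap E$ and $\bar a_p=M$. Then $\bar a^{\mathsf T}x\le b$ defines a facet of $\textsc{Bond}(\bar G)$.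
   Context: For a graph $G=(V,E)$ and $S\subseteq V$, the cut $\delta(S)=\{e\in E:|e\cap S|=1\}$ is a bond if $G[S]$ and $G[V\setminus S]$ are connected. $x^\delta$ is the incidence vector, $\textsc{Bond}(G)=\mathrm{conv}\{x^\delta:\delta\text{ a bond}\}$. An induced path is a path that is an induced subgraph.
   Formalization: The path P is additionally required to have all inner vertices of degree 2 in G, so that replacing P by the edge p yields a graph; for arbitrary induced paths the claim fails (e.g. K4 minus an edge). P has at least one edge, and the empty cut counts as a bond. *)

theory Defs
  imports "HOL-Analysis.Analysis"
begin

definition simple_graph :: "'a set \<Rightarrow> 'a set set \<Rightarrow> bool" where
  "simple_graph V E \<longleftrightarrow> finite V \<and> (\<forall>e\<in>E. e \<subseteq> V \<and> card e = 2)"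

text \<open>The graph without vertices counts as connected, so that the empty cut
  \<open>\<delta>(\<emptyset>) = \<delta>(V)\<close> is a bond of every connected graph.  With this convention the bond
  polytope of a connected graph is full-dimensional.\<close>

definition connected_graph :: "'a set \<Rightarrow> 'a set set \<Rightarrow> bool" where
  "connected_graph V E \<longleftrightarrow>
     (\<forall>u\<in>V. \<forall>v\<in>V. (u, v) \<in> {(x, y). x \<in> V \<and> y \<in> V \<and> {x, y} \<in> E}\<^sup>*)"

definition induced_edges :: "'a set set \<Rightarrow> 'a set \<Rightarrow> 'a set set" where
  "induced_edges E S = {e \<in> E. e \<subseteq> S}"

definition cut :: "'a set set \<Rightarrow> 'a set \<Rightarrow> 'a set set" where
  "cut E S = {e \<in> E. card (e \<inter> S) = 1}"

definition bonds :: "'a set \<Rightarrow> 'a set set \<Rightarrow> 'a set set set" where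
  "bonds V E = {cut E S |S. S \<subseteq> V \<and> connected_graph S (induced_edges E S)
                          \<and> connected_graph (V - S) (induced_edges E (V - S))}"

text \<open>The space \<open>\<real>\<^sup>E\<close> is realised as the coordinate subspace of \<open>\<real>\<close>-valued vectors,
  indexed by all subsets of the finite vertex type, that vanish outside \<open>E\<close>.  In this way
  graphs with different edge sets live in one Euclidean space.\<close>

definition edge_space :: "'a set set \<Rightarrow> (real ^ ('a::finite set)) set" where
  "edge_space E = {x. \<forall>e. e \<notin> E \<longrightarrow> x $ e = 0}"

definition incidence_vector :: "'a set set \<Rightarrow> real ^ ('a::finite set)" where
  "incidence_vector D = (\<chi> e. if e \<in> D then 1 else 0)"

definition bond_polytope :: "'a set \<Rightarrow> 'a set set \<Rightarrow> (real ^ ('a::finite set)) set" where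
  "bond_polytope V E = convex hull (incidence_vector ` bonds V E)"

definition facet_defining :: "'v::euclidean_space set \<Rightarrow> 'v \<Rightarrow> real \<Rightarrow> bool" where
  "facet_defining Q a b \<longleftrightarrow> (\<forall>x\<in>Q. a \<bullet> x \<le> b) \<and> {x \<in> Q. a \<bullet> x = b} facet_of Q"

definition tight_bonds ::
  "'a set \<Rightarrow> 'a set set \<Rightarrow> real ^ ('a::finite set) \<Rightarrow> real \<Rightarrow> 'a set set set" where
  "tight_bonds V E a b = {D \<in> bonds V E. a \<bullet> incidence_vector D = b}"

text \<open>A path is given by the list of its vertices.\<close>

definition path_edges :: "'a list \<Rightarrow> 'a set set" where
  "path_edges ps = {{ps ! i, ps ! Suc i} |i. Suc i < length ps}"

definition is_path :: "'a set \<Rightarrow> 'a set set \<Rightarrow> 'a list \<Rightarrow> bool" where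
  "is_path V E ps \<longleftrightarrow> ps \<noteq> [] \<and> distinct ps \<and> set ps \<subseteq> V \<and> path_edges ps \<subseteq> E"

definition induced_path :: "'a set \<Rightarrow> 'a set set \<Rightarrow> 'a list \<Rightarrow> bool" where
  "induced_path V E ps \<longleftrightarrow> is_path V E ps \<and> induced_edges E (set ps) = path_edges ps"

definition end_edge :: "'a list \<Rightarrow> 'a set" where
  "end_edge ps = {hd ps, last ps}"

definition inner_vertices :: "'a list \<Rightarrow> 'a set" where
  "inner_vertices ps = set ps - {hd ps, last ps}"

text \<open>Replacing a path by a single edge removes the edges and the inner vertices of the path.
  The resulting pair is a graph exactly if no further edge is incident with an inner vertex,
  see \<open>simple_graph_replace_path_iff\<close> below.\<close>

definition replace_path_vertices :: "'a set \<Rightarrow> 'a list \<Rightarrow> 'a set" where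
  "replace_path_vertices V ps = V - inner_vertices ps"

definition replace_path_edges :: "'a set set \<Rightarrow> 'a list \<Rightarrow> 'a set set" where
  "replace_path_edges E ps = insert (end_edge ps) (E - path_edges ps)"

lemma simple_graph_replace_path_iff:
  assumes G: "simple_graph V E" and P: "induced_path V E ps" and len: "2 \<le> length ps"
  shows "simple_graph (replace_path_vertices V ps) (replace_path_edges E ps)
         \<longleftrightarrow> (\<forall>v\<in>inner_vertices ps. card {e \<in> E. v \<in> e} = 2)"
proof -
  have ne: "ps \<noteq> []" and dist: "distinct ps" and sub: "set ps \<subseteq> V" and pE: "path_edges ps \<subseteq> E"
    using P by (auto simp: induced_path_def is_path_def)
  have hl: "hd ps \<noteq> last ps"
    using dist len ne by (simp add: hd_conv_nth last_conv_nth nth_eq_iff_index_eq)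
  have inner: "card {e \<in> path_edges ps. v \<in> e} = 2" if v: "v \<in> inner_vertices ps" for v
  proof -
    obtain i where i: "i < length ps" "v = ps ! i"
      using v by (auto simp: inner_vertices_def in_set_conv_nth)
    have "i \<noteq> 0" using v i ne by (metis Diff_iff hd_conv_nth inner_vertices_def insertI1)
    then obtain j where j: "i = Suc j" by (cases i) auto
    have "Suc i \<noteq> length ps"
    proof
      assume "Suc i = length ps"
      then have "v = last ps" using i ne by (simp add: last_conv_nth flip: \<open>Suc i = length ps\<close>)
      then show False using v by (simp add: inner_vertices_def)
    qed
    then have si: "Suc i < length ps" using i by simp
    have "{e \<in> path_edges ps. v \<in> e} = {{ps ! j, v}, {v, ps ! Suc i}}" (is "?A = ?B")
    proof
      show "?A \<subseteq> ?B"
      proof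
        fix e assume "e \<in> ?A"
        then obtain k where k: "Suc k < length ps" "e = {ps ! k, ps ! Suc k}" "v \<in> e"
          by (auto simp: path_edges_def)
        then have "i = k \<or> i = Suc k"
          using i dist by (auto simp: nth_eq_iff_index_eq)
        then show "e \<in> ?B" using k i j by auto
      qed
      show "?B \<subseteq> ?A" using i j si by (auto simp: path_edges_def)
    qed
    moreover have "{ps ! j, v} \<noteq> {v, ps ! Suc i}"
      using i j si dist by (auto simp: doubleton_eq_iff nth_eq_iff_index_eq)
    ultimately show ?thesis by simp
  qed
  have finE: "finite E"
    using G by (auto simp: simple_graph_def intro: finite_subset[of _ "Pow V"])
  have deg: "card {e \<in> E. v \<in> e} = 2 \<longleftrightarrow> (\<forall>e\<in>E - path_edges ps. v \<notin> e)"
    if v: "v \<in> inner_vertices ps" for v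
  proof
    assume c: "card {e \<in> E. v \<in> e} = 2"
    have "{e \<in> path_edges ps. v \<in> e} = {e \<in> E. v \<in> e}"
      by (rule card_subset_eq) (use finE pE c inner[OF v] in auto)
    then show "\<forall>e\<in>E - path_edges ps. v \<notin> e" by blast
  next
    assume "\<forall>e\<in>E - path_edges ps. v \<notin> e"
    then have "{e \<in> E. v \<in> e} = {e \<in> path_edges ps. v \<in> e}" using pE by blast
    then show "card {e \<in> E. v \<in> e} = 2" using inner[OF v] by simp
  qed
  have ends: "end_edge ps \<subseteq> V - inner_vertices ps" "card (end_edge ps) = 2"
    using sub ne hl by (auto simp: end_edge_def inner_vertices_def)
  have "simple_graph (replace_path_vertices V ps) (replace_path_edges E ps)
        \<longleftrightarrow> (\<forall>e\<in>E - path_edges ps. e \<inter> inner_vertices ps = {})"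
    using G ends by (auto simp: simple_graph_def replace_path_vertices_def replace_path_edges_def)
  also have "\<dots> \<longleftrightarrow> (\<forall>v\<in>inner_vertices ps. \<forall>e\<in>E - path_edges ps. v \<notin> e)" by blast
  also have "\<dots> \<longleftrightarrow> (\<forall>v\<in>inner_vertices ps. card {e \<in> E. v \<in> e} = 2)" using deg by blast
  finally show ?thesis .
qed

end

theory Submission
  imports Defs
begin

text \<open>The bond polytope of a connected graph is full-dimensional and contains \<open>0\<close>, so a valid
  inequality is facet-defining iff it is, up to scaling, the only equation satisfied by all
  tight bonds. A bond of \<open>G\<close> meets the path \<open>P\<close> in at most two edges. Those meeting it in at most
  one edge correspond to bonds of the reduced graph, with the path edge playing the role of \<open>p\<close>
  and being freely exchangeable, so that a tight one uses an edge of maximal coefficient \<open>M\<close>.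
  Those meeting it in two edges consist of just these two edges, and if one such bond exists, then
  every pair of path edges is a bond. As every path edge lies in a tight bond, either all path
  edges have coefficient \<open>M\<close> and no tight bond contains two of them, or exactly one path edge has
  coefficient \<open>M\<close> and all others have \<open>b - M < M\<close>. In both cases an equation for the tight bonds
  of the reduced graph lifts to one for the tight bonds of \<open>G\<close>, hence is a multiple of the given
  one.\<close>

section \<open>Facets of a full-dimensional polytope via equations on tight points\<close>

text \<open>Since \<open>X\<close> spans \<open>U\<close> and contains 0, the hull has dimension
  \<open>dim U\<close>. For \<open>a \<noteq> 0\<close>, a nonempty tight face is a facet iff its
  directions fill the hyperplane \<open>W\<close> of \<open>U\<close> orthogonal to
  \<open>a\<close>, that is, iff only multiples of \<open>a\<close> are orthogonal to all of
  them.\<close>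

lemma facet_defining_convex_hull_iff:
  fixes X U :: "'v::euclidean_space set"
  assumes fin: "finite X" and U: "subspace U" and XU: "X \<subseteq> U" and X0: "0 \<in> X"
    and full: "\<And>c. c \<in> U \<Longrightarrow> (\<And>x. x \<in> X \<Longrightarrow> c \<bullet> x = 0) \<Longrightarrow> c = 0" and aU: "a \<in> U"
  shows "facet_defining (convex hull X) a b \<longleftrightarrow>
    (\<forall>x\<in>X. a \<bullet> x \<le> b) \<and> a \<noteq> 0 \<and>
    (\<forall>c\<in>U. \<forall>d. (\<forall>x\<in>X. a \<bullet> x = b \<longrightarrow> c \<bullet> x = d) \<longrightarrow> (\<exists>t. c = t *\<^sub>R a \<and> d = t * b))"
    (is "?L \<longleftrightarrow> ?R")
proof -
  let ?Q = "convex hull X"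
  define F where "F = {x \<in> ?Q. a \<bullet> x = b}"
  define W where "W = U \<inter> {y. a \<bullet> y = 0}"
  have QU: "?Q \<subseteq> U"
    by (rule hull_minimal) (use XU U subspace_imp_convex in auto)
  have subW: "subspace W"
    unfolding W_def using U by (intro subspace_inter subspace_hyperplane)
  have spX: "span X = U"
  proof (rule ccontr)
    assume ne: "span X \<noteq> U"
    have "span X \<subseteq> U" using XU U by (simp add: span_minimal)
    with ne have "span X \<subset> span U" using U by (simp add: span_eq_iff[THEN iffD2] psubset_eq)
    then obtain c where "c \<noteq> 0" "c \<in> span U" "\<And>y. y \<in> span X \<Longrightarrow> orthogonal c y"
      using orthogonal_to_subspace_exists_gen by metis
    then show False
      using full[of c] U by (auto simp: orthogonal_def span_base span_eq_iff[THEN iffD2])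
  qed
  have dimQ: "aff_dim ?Q = int (dim U)"
  proof -
    have "aff_dim X = int (dim X)"
      by (rule aff_dim_zero) (use X0 in \<open>simp add: hull_inc\<close>)
    then show ?thesis using spX by (metis aff_dim_convex_hull dim_span)
  qed
  have valid: "(\<forall>x\<in>?Q. a \<bullet> x \<le> b) \<longleftrightarrow> (\<forall>x\<in>X. a \<bullet> x \<le> b)"
  proof
    assume "\<forall>x\<in>X. a \<bullet> x \<le> b"
    then have "?Q \<subseteq> {x. a \<bullet> x \<le> b}"
      by (intro hull_minimal) (auto simp: convex_halfspace_le)
    then show "\<forall>x\<in>?Q. a \<bullet> x \<le> b" by blast
  qed (auto simp: hull_inc)
  \<comment> \<open>\<open>a\<close> lies in \<open>U\<close> but not in its own orthogonal
    hyperplane, so intersecting costs exactly one dimension.\<close>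
  have dimW: "int (dim W) = int (dim U) - 1" if "a \<noteq> 0"
  proof -
    have "\<not> U \<subseteq> {y. a \<bullet> y = 0}" using aU that by auto
    moreover have "0 \<in> U \<inter> {y. a \<bullet> y = 0}" using U subspace_0 by auto
    ultimately have "aff_dim W = aff_dim U - 1"
      unfolding W_def using aff_dim_affine_Int_hyperplane[OF subspace_imp_affine[OF U], of a 0]
      by auto
    then show ?thesis using U subW by (simp add: aff_dim_subspace)
  qed
  have face: "F face_of ?Q" if "\<forall>x\<in>X. a \<bullet> x \<le> b"
  proof -
    have "F = ?Q \<inter> {x. a \<bullet> x = b}" by (auto simp: F_def)
    then show ?thesis
      using that valid by (simp add: face_of_Int_supporting_hyperplane_le)
  qed
  have dimF: "aff_dim F = int (dim (span ((\<lambda>x. x - x0) ` F)))" if "x0 \<in> F" for x0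
  proof -
    have "aff_dim F = int (dim ((\<lambda>x. - x0 + x) ` F))"
      by (rule aff_dim_eq_dim) (use that in \<open>simp add: hull_inc\<close>)
    then show ?thesis by simp
  qed
  have FW: "span ((\<lambda>x. x - x0) ` F) \<subseteq> W" if "x0 \<in> F" for x0
    by (rule span_minimal[OF _ subW])
      (use that QU U in \<open>auto simp: F_def W_def inner_diff_right intro: subspace_diff\<close>)
  show ?thesis
  proof
    assume ?L
    then have v: "\<forall>x\<in>X. a \<bullet> x \<le> b" and Ff: "F facet_of ?Q"
      using valid by (auto simp: facet_defining_def F_def)
    have Fne: "F \<noteq> {}" and Fd: "aff_dim F = aff_dim ?Q - 1"
      using Ff by (auto simp: facet_of_def)
    then obtain x0 where x0: "x0 \<in> F" by blast
    have a0: "a \<noteq> 0"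
    proof
      assume "a = 0"
      then have "F = ?Q" using x0 by (auto simp: F_def)
      then show False using Fd by simp
    qed
    have "span ((\<lambda>x. x - x0) ` F) = W"
      by (rule subspace_dim_equal)
        (use subW FW[OF x0] dimW[OF a0] Fd dimF[OF x0] dimQ in auto)
    then have spF: "W = span ((\<lambda>x. x - x0) ` F)" ..
    have "\<exists>t. c = t *\<^sub>R a \<and> d = t * b"
      if c: "c \<in> U" and cd: "\<And>x. x \<in> X \<Longrightarrow> a \<bullet> x = b \<Longrightarrow> c \<bullet> x = d" for c d
    proof -
      \<comment> \<open>A face of the hull of \<open>X\<close> is the hull of some points of
        \<open>X\<close>. These are tight, so an equation on the tight points extends to all of
        \<open>F\<close>.\<close>
      obtain X' where X': "X' \<subseteq> X" "F = convex hull X'"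
        using face_of_convex_hull_subset[OF finite_imp_compact[OF fin] face[OF v]] by blast
      have "X' \<subseteq> {x. c \<bullet> x = d}"
      proof
        fix x assume "x \<in> X'"
        then have "x \<in> X" "x \<in> F" using X' by (auto simp: hull_inc)
        then show "x \<in> {x. c \<bullet> x = d}" using cd by (auto simp: F_def)
      qed
      then have "F \<subseteq> {x. c \<bullet> x = d}"
        unfolding X'(2) by (intro hull_minimal) (auto simp: convex_hyperplane)
      then have cF: "c \<bullet> x = d" if "x \<in> F" for x using that by blast
      have cW: "W \<subseteq> {y. c \<bullet> y = 0}"
        unfolding spF
        by (rule span_minimal[OF _ subspace_hyperplane]) (use cF x0 in \<open>auto simp: inner_diff_right\<close>)
      \<comment> \<open>\<open>t *\<^sub>R a\<close> is the orthogonal projection of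
        \<open>c\<close> onto the line of \<open>a\<close>. The remainder lies in \<open>W\<close>,
        where \<open>c\<close> vanishes, so it is orthogonal to itself.\<close>
      define t where "t = (a \<bullet> c) / (a \<bullet> a)"
      let ?y = "c - t *\<^sub>R a"
      have ay: "a \<bullet> ?y = 0" using a0 by (simp add: inner_diff_right t_def)
      then have "?y \<in> W" using c aU U by (auto simp: W_def subspace_diff subspace_mul)
      then have "c \<bullet> ?y = 0" using cW by blast
      then have "?y \<bullet> ?y = 0" using ay by (simp add: inner_diff_left)
      then have "c = t *\<^sub>R a" by simp
      moreover have "d = t * b"
        using cF[OF x0] x0 calculation by (simp add: F_def)
      ultimately show ?thesis by blast
    qed
    then show ?R using v a0 by blast
  next
    assume R: ?R
    then have v: "\<forall>x\<in>X. a \<bullet> x \<le> b" and a0: "a \<noteq> 0"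
      and uniq: "\<And>c d. c \<in> U \<Longrightarrow> (\<And>x. x \<in> X \<Longrightarrow> a \<bullet> x = b \<Longrightarrow> c \<bullet> x = d) \<Longrightarrow>
                  \<exists>t. c = t *\<^sub>R a \<and> d = t * b"
      by blast+
    \<comment> \<open>Without tight points the equation 0 = 1 would hold on them vacuously and be a
      multiple of the given one, impossible for \<open>a \<noteq> 0\<close>.\<close>
    have "\<exists>x\<in>X. a \<bullet> x = b"
    proof (rule ccontr)
      assume "\<not> ?thesis"
      then obtain t where "0 = t *\<^sub>R a" "1 = t * b"
        using uniq[of 0 1] U subspace_0 by auto
      then show False using a0 by auto
    qed
    then obtain x0 where "x0 \<in> X" "a \<bullet> x0 = b" by blast
    then have x0: "x0 \<in> F" by (simp add: F_def hull_inc)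
    have "span ((\<lambda>x. x - x0) ` F) = W"
    proof (rule ccontr)
      assume "span ((\<lambda>x. x - x0) ` F) \<noteq> W"
      then have "span ((\<lambda>x. x - x0) ` F) \<subset> span W"
        using FW[OF x0] subW by (simp add: span_eq_iff[THEN iffD2] psubset_eq)
      \<comment> \<open>Such a \<open>c\<close> is constant on the tight points, hence a multiple of
        \<open>a\<close>; being also orthogonal to \<open>a\<close>, it is 0.\<close>
      then obtain c where c: "c \<noteq> 0" "c \<in> span W"
        "\<And>y. y \<in> span ((\<lambda>x. x - x0) ` F) \<Longrightarrow> orthogonal c y"
        using orthogonal_to_subspace_exists_gen by metis
      have cW: "c \<in> W" using c(2) subW by (simp add: span_eq_iff[THEN iffD2])
      have "c \<bullet> x = c \<bullet> x0" if "x \<in> X" "a \<bullet> x = b" for x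
      proof -
        have "x \<in> F" using that by (simp add: F_def hull_inc)
        then have "orthogonal c (x - x0)" by (intro c(3) span_base) auto
        then show ?thesis by (simp add: orthogonal_def inner_diff_right)
      qed
      then obtain t where "c = t *\<^sub>R a"
        using uniq[of c "c \<bullet> x0"] cW by (auto simp: W_def)
      then show False using cW c(1) a0 by (auto simp: W_def)
    qed
    then have "aff_dim F = aff_dim ?Q - 1"
      using dimF[OF x0] dimW[OF a0] dimQ by simp
    then have "F facet_of ?Q" using face[OF v] x0 by (auto simp: facet_of_def)
    then show ?L using v valid by (simp add: facet_defining_def F_def)
  qed
qed

section \<open>Adjacency and transport of connectivity\<close>

text \<open>The relation inside \<open>connected_graph\<close>. With the full edge set as argument,
  connectivity of induced subgraphs can be stated without \<open>induced_edges\<close>.\<close>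

definition adj :: "'a set \<Rightarrow> 'a set set \<Rightarrow> ('a \<times> 'a) set" where
  "adj A E = {(x, y). x \<in> A \<and> y \<in> A \<and> {x, y} \<in> E}"

lemma adj_iff: "(x, y) \<in> adj A E \<longleftrightarrow> x \<in> A \<and> y \<in> A \<and> {x, y} \<in> E"
  by (simp add: adj_def)

lemma connected_graph_adj:
  "connected_graph A E \<longleftrightarrow> (\<forall>u\<in>A. \<forall>v\<in>A. (u, v) \<in> (adj A E)\<^sup>*)"
  by (simp add: connected_graph_def adj_def)

lemma connected_graph_induced: "connected_graph A (induced_edges E A) \<longleftrightarrow> connected_graph A E"
proof -
  have "adj A (induced_edges E A) = adj A E" by (auto simp: adj_def induced_edges_def)
  then show ?thesis by (simp add: connected_graph_adj)
qed

lemma adj_rtrancl_sym: "(x, y) \<in> (adj A E)\<^sup>* \<Longrightarrow> (y, x) \<in> (adj A E)\<^sup>*"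
proof -
  have "sym (adj A E)" by (auto simp: sym_def adj_def insert_commute)
  then show "(x, y) \<in> (adj A E)\<^sup>* \<Longrightarrow> (y, x) \<in> (adj A E)\<^sup>*" by (meson symE sym_rtrancl)
qed

text \<open>Walks are mapped step by step, each edge either collapsing or becoming an edge of
  \<open>E'\<close>. This serves to contract parts of the path.\<close>

lemma connected_graph_image:
  assumes A: "connected_graph A E" and B: "f ` A = B"
    and step: "\<And>x y. x \<in> A \<Longrightarrow> y \<in> A \<Longrightarrow> {x, y} \<in> E \<Longrightarrow> f x \<noteq> f y \<Longrightarrow> {f x, f y} \<in> E'"
  shows "connected_graph B E'"
  unfolding connected_graph_adj
proof (intro ballI)
  have *: "(f x, f y) \<in> (adj B E')\<^sup>*" if "(x, y) \<in> (adj A E)\<^sup>*" for x y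
    using that
  proof (induction rule: rtrancl_induct)
    case (step y z)
    have "f y = f z \<or> (f y, f z) \<in> adj B E'"
      using step.hyps(2) B assms(3)[of y z] by (auto simp: adj_iff)
    then show ?case using step.IH by (auto intro: rtrancl_into_rtrancl)
  qed simp
  fix u v assume "u \<in> B" "v \<in> B"
  then obtain x y where "x \<in> A" "y \<in> A" "u = f x" "v = f y" using B by blast
  then show "(u, v) \<in> (adj B E')\<^sup>*" using * A by (auto simp: connected_graph_adj)
qed

text \<open>Two vertices of \<open>A\<close> are joined by going to \<open>B\<close>, simulating a
  walk of \<open>B\<close> edge by edge, and coming back. This serves to reinsert the path.\<close>

lemma connected_graph_extend:
  assumes B: "connected_graph B E'"
    and step: "\<And>x y. x \<in> B \<Longrightarrow> y \<in> B \<Longrightarrow> {x, y} \<in> E' \<Longrightarrow> (x, y) \<in> (adj A E)\<^sup>*"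
    and reach: "\<And>x. x \<in> A \<Longrightarrow> \<exists>y\<in>B. (x, y) \<in> (adj A E)\<^sup>*"
  shows "connected_graph A E"
  unfolding connected_graph_adj
proof (intro ballI)
  have *: "(x, y) \<in> (adj A E)\<^sup>*" if "(x, y) \<in> (adj B E')\<^sup>*" for x y
    using that
  proof (induction rule: rtrancl_induct)
    case (step y z)
    then show ?case using assms(2)[of y z] by (auto simp: adj_iff)
  qed simp
  fix u v assume "u \<in> A" "v \<in> A"
  then obtain x y where xy: "x \<in> B" "y \<in> B" "(u, x) \<in> (adj A E)\<^sup>*" "(v, y) \<in> (adj A E)\<^sup>*"
    using reach by blast
  moreover have "(x, y) \<in> (adj A E)\<^sup>*" using * B xy by (auto simp: connected_graph_adj)
  ultimately show "(u, v) \<in> (adj A E)\<^sup>*" by (meson adj_rtrancl_sym rtrancl_trans)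
qed

section \<open>Cuts and bonds\<close>

lemma card_doubleton_Int_eq_1:
  "x \<noteq> y \<Longrightarrow> card ({x, y} \<inter> S) = 1 \<longleftrightarrow> (x \<in> S) \<noteq> (y \<in> S)"
  by (cases "x \<in> S"; cases "y \<in> S") (auto simp: Int_insert_left)

lemma mem_cut_doubleton:
  "x \<noteq> y \<Longrightarrow> {x, y} \<in> cut E S \<longleftrightarrow> {x, y} \<in> E \<and> (x \<in> S) \<noteq> (y \<in> S)"
  unfolding cut_def using card_doubleton_Int_eq_1 by fast

lemma cut_complement:
  assumes "\<And>e. e \<in> E \<Longrightarrow> e \<subseteq> V \<and> card e = 2"
  shows "cut E (V - S) = cut E S"
proof -
  have "e \<in> cut E (V - S) \<longleftrightarrow> e \<in> cut E S" if "e \<in> E" for e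
  proof -
    obtain x y where "e = {x, y}" "x \<noteq> y" "x \<in> V" "y \<in> V"
      using assms \<open>e \<in> E\<close> by (metis card_2_iff insert_subset)
    then show ?thesis by (auto simp: mem_cut_doubleton)
  qed
  then show ?thesis by (auto simp: cut_def)
qed

lemma bonds_iff:
  "D \<in> bonds V E \<longleftrightarrow>
    (\<exists>S\<subseteq>V. D = cut E S \<and> connected_graph S E \<and> connected_graph (V - S) E)"
  by (auto simp: bonds_def connected_graph_induced)

text \<open>The empty side counts as connected. This bond puts the point 0 into the
  polytope.\<close>

lemma empty_in_bonds: "connected_graph V E \<Longrightarrow> {} \<in> bonds V E"
  unfolding bonds_iff by (rule exI[of _ "{}"]) (auto simp: cut_def connected_graph_adj)

lemma inner_incidence_vector: "a \<bullet> incidence_vector D = (\<Sum>e\<in>D. a $ e)"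
  by (simp add: inner_vec_def incidence_vector_def if_distrib sum.If_cases cong: if_cong)

section \<open>Full-dimensionality of the bond polytope\<close>

text \<open>If \<open>G - S\<close> splits into \<open>C\<close> and \<open>D\<close> without edges in between, then \<open>\<delta>(S)\<close> is the disjoint
  union of \<open>\<delta>(S \<union> C)\<close> and \<open>\<delta>(S \<union> D)\<close>, and both sets are again connected.\<close>

lemma connected_cut_sum_eq_0:
  fixes c :: "'a::finite set \<Rightarrow> real"
  assumes G: "simple_graph V E" and con: "connected_graph V E"
    and c: "\<And>D. D \<in> bonds V E \<Longrightarrow> sum c D = 0"
    and S: "S \<subseteq> V" "S \<noteq> {}" "connected_graph S E"
  shows "sum c (cut E S) = 0"
  using S
proof (induction "card (V - S)" arbitrary: S rule: less_induct)
  case less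
  show ?case
  proof (cases "connected_graph (V - S) E")
    case True
    then show ?thesis using less.prems by (intro c) (auto simp: bonds_iff)
  next
    case False
    then obtain u w where uw: "u \<in> V - S" "w \<in> V - S" "(u, w) \<notin> (adj (V - S) E)\<^sup>*"
      by (auto simp: connected_graph_adj)
    \<comment> \<open>\<open>C\<close> is the component of \<open>u\<close> in \<open>G - S\<close>,
      and \<open>D\<close> collects all other components, among them that of
      \<open>w\<close>.\<close>
    define C where "C = {x \<in> V - S. (u, x) \<in> (adj (V - S) E)\<^sup>*}"
    define D where "D = V - S - C"
    have CD: "u \<in> C" "w \<in> D" "C \<union> D = V - S" "C \<inter> D = {}"
      using uw by (auto simp: C_def D_def)
    have noedge: "{x, y} \<notin> E" if "x \<in> C" "y \<in> D" for x y
    proof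
      assume "{x, y} \<in> E"
      then have "(x, y) \<in> adj (V - S) E" using that by (auto simp: adj_iff C_def D_def)
      then have "y \<in> C" using that
        by (auto simp: C_def D_def intro: rtrancl_into_rtrancl)
      then show False using that by (auto simp: D_def)
    qed
    have join: "connected_graph (S \<union> B) E"
      if AB: "A \<union> B = V - S" "A \<inter> B = {}" "\<And>x y. x \<in> A \<Longrightarrow> y \<in> B \<Longrightarrow> {x, y} \<notin> E" for A B
    proof (rule connected_graph_extend[OF less.prems(3)])
      fix x y assume "x \<in> S" "y \<in> S" "{x, y} \<in> E"
      then show "(x, y) \<in> (adj (S \<union> B) E)\<^sup>*" by (auto simp: adj_iff)
    next
      obtain s where s: "s \<in> S" using less.prems by blast
      have mono: "(adj S E)\<^sup>* \<subseteq> (adj (S \<union> B) E)\<^sup>*"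
        by (rule rtrancl_mono) (auto simp: adj_def)
      \<comment> \<open>A walk in \<open>G\<close> that strays into \<open>A\<close> can come back
        only through \<open>S\<close>, as no edge joins \<open>A\<close> to \<open>B\<close>;
        connectivity of \<open>S\<close> then replaces the detour.\<close>
      have "x \<in> S \<union> B \<longrightarrow> (s, x) \<in> (adj (S \<union> B) E)\<^sup>*" if "(s, x) \<in> (adj V E)\<^sup>*" for x
        using that
      proof (induction rule: rtrancl_induct)
        case (step y z)
        show ?case
        proof (intro impI)
          assume z: "z \<in> S \<union> B"
          show "(s, z) \<in> (adj (S \<union> B) E)\<^sup>*"
          proof (cases "y \<in> A")
            case True
            then have "z \<in> S" using z AB(3)[of y z] step.hyps(2) by (auto simp: adj_iff)
            then show ?thesis using s less.prems(3) mono by (auto simp: connected_graph_adj)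
          next
            case False
            then have "y \<in> S \<union> B" using step.hyps(2) AB(1) by (auto simp: adj_iff)
            then have "(s, y) \<in> (adj (S \<union> B) E)\<^sup>*" "(y, z) \<in> adj (S \<union> B) E"
              using step z by (auto simp: adj_iff)
            then show ?thesis by (rule rtrancl_into_rtrancl)
          qed
        qed
      qed simp
      moreover fix x assume x: "x \<in> S \<union> B"
      moreover have "x \<in> V" "s \<in> V" using x AB less.prems s by auto
      ultimately show "\<exists>y\<in>S. (x, y) \<in> (adj (S \<union> B) E)\<^sup>*"
        using s con unfolding connected_graph_adj by (meson adj_rtrancl_sym)
    qed
    have fin: "finite V" using G by (simp add: simple_graph_def)
    have "sum c (cut E (S \<union> C)) = 0"
    proof (rule less.hyps)
      show "card (V - (S \<union> C)) < card (V - S)"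
        by (rule psubset_card_mono) (use fin CD in auto)
      show "connected_graph (S \<union> C) E"
        by (rule join[of D C]) (use CD noedge in \<open>auto, metis insert_commute\<close>)
    qed (use less.prems CD in auto)
    moreover have "sum c (cut E (S \<union> D)) = 0"
    proof (rule less.hyps)
      show "card (V - (S \<union> D)) < card (V - S)"
        by (rule psubset_card_mono) (use fin CD in auto)
      show "connected_graph (S \<union> D) E"
        by (rule join[of C D]) (use CD noedge in auto)
    qed (use less.prems CD in auto)
    \<comment> \<open>An edge of the cut has its outer end in \<open>C\<close> or in
      \<open>D\<close>; in the first case only \<open>S \<union> D\<close> cuts it, in the second
      only \<open>S \<union> C\<close>.\<close>
    moreover have edge: "(e \<in> cut E S \<longleftrightarrow> e \<in> cut E (S \<union> C) \<or> e \<in> cut E (S \<union> D)) \<and>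
       \<not> (e \<in> cut E (S \<union> C) \<and> e \<in> cut E (S \<union> D))" if eE: "e \<in> E" for e
    proof -
      obtain x y where e: "e = {x, y}" "x \<noteq> y" "x \<in> V" "y \<in> V"
        using G eE unfolding simple_graph_def by (metis card_2_iff insert_subset)
      have "x \<in> S \<or> x \<in> C \<or> x \<in> D" "y \<in> S \<or> y \<in> C \<or> y \<in> D" "C \<inter> S = {}" "D \<inter> S = {}"
        using e CD by auto
      moreover have "\<not> (x \<in> C \<and> y \<in> D)" "\<not> (x \<in> D \<and> y \<in> C)"
        using noedge[of x y] noedge[of y x] eE e by (auto simp: insert_commute)
      ultimately show ?thesis using e CD(4) eE by (simp add: mem_cut_doubleton) blast
    qed
    moreover have "cut E S = cut E (S \<union> C) \<union> cut E (S \<union> D)"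
        "cut E (S \<union> C) \<inter> cut E (S \<union> D) = {}"
      using edge by (auto simp: cut_def)
    ultimately show ?thesis by (simp add: sum.union_disjoint)
  qed
qed

text \<open>For an edge \<open>e\<close> with ends \<open>x\<close>, \<open>y\<close>, the sums over
  the cuts of \<open>{x}\<close>, \<open>{y}\<close> and \<open>{x, y}\<close> vanish by the
  previous lemma. The first two cuts share exactly \<open>e\<close>, and the third is their
  symmetric difference, so twice the coefficient of \<open>e\<close> is 0.\<close>

lemma bonds_full_dimensional:
  fixes c :: "real ^ ('a::finite set)"
  assumes G: "simple_graph V E" and con: "connected_graph V E" and cE: "c \<in> edge_space E"
    and c: "\<And>D. D \<in> bonds V E \<Longrightarrow> c \<bullet> incidence_vector D = 0"
  shows "c = 0"
proof -
  have cut0: "sum (($) c) (cut E S) = 0" if "S \<subseteq> V" "S \<noteq> {}" "connected_graph S E" for S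
    using connected_cut_sum_eq_0[OF G con _ that, of "($) c"] c
    by (simp add: inner_incidence_vector)
  have "c $ e = 0" if e: "e \<in> E" for e
  proof -
    obtain x y where xy: "e = {x, y}" "x \<noteq> y" "x \<in> V" "y \<in> V"
      using G e unfolding simple_graph_def by (metis card_2_iff insert_subset)
    have "sum (($) c) (cut E {x}) = 0" "sum (($) c) (cut E {y}) = 0"
      "sum (($) c) (cut E {x, y}) = 0"
      using xy e by (intro cut0; force simp: connected_graph_adj adj_iff insert_commute)+
    moreover have edge: "(f \<in> cut E {x} \<and> f \<in> cut E {y} \<longleftrightarrow> f = e) \<and>
        (f \<in> cut E {x, y} \<longleftrightarrow> (f \<in> cut E {x} \<or> f \<in> cut E {y}) \<and> f \<noteq> e)" if f: "f \<in> E" for f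
    proof -
      obtain u w where "f = {u, w}" "u \<noteq> w"
        using G f unfolding simple_graph_def by (metis card_2_iff)
      then show ?thesis using xy f by (auto simp: mem_cut_doubleton doubleton_eq_iff)
    qed
    have "cut E {x} \<inter> cut E {y} = {e}" "cut E {x, y} = cut E {x} \<union> cut E {y} - {e}"
      using edge e by (auto simp: cut_def)
    moreover have "sum (($) c) (cut E {x} \<union> cut E {y}) + sum (($) c) (cut E {x} \<inter> cut E {y})
        = sum (($) c) (cut E {x}) + sum (($) c) (cut E {y})"
      by (simp add: sum.union_inter)
    moreover have "e \<in> cut E {x} \<union> cut E {y}" using edge e by blast
    then have "sum (($) c) (cut E {x} \<union> cut E {y} - {e})
        = sum (($) c) (cut E {x} \<union> cut E {y}) - c $ e"
      by (simp add: sum_diff1)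
    ultimately show ?thesis by simp
  qed
  then show ?thesis using cE by (auto simp: vec_eq_iff edge_space_def)
qed

text \<open>The criterion for convex hulls with \<open>U\<close> the edge space. It is applied to
  \<open>G\<close> to use the hypothesis and to the reduced graph to reach the conclusion.\<close>

lemma facet_defining_bond_polytope_iff:
  fixes a :: "real ^ ('a::finite set)"
  assumes G: "simple_graph V E" and con: "connected_graph V E" and a: "a \<in> edge_space E"
  shows "facet_defining (bond_polytope V E) a b \<longleftrightarrow>
    (\<forall>D\<in>bonds V E. a \<bullet> incidence_vector D \<le> b) \<and> a \<noteq> 0 \<and>
    (\<forall>c\<in>edge_space E. \<forall>d. (\<forall>D\<in>tight_bonds V E a b. c \<bullet> incidence_vector D = d) \<longrightarrow>
       (\<exists>t. c = t *\<^sub>R a \<and> d = t * b))"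
proof -
  have sub: "subspace (edge_space E)" by (auto simp: subspace_def edge_space_def)
  have "incidence_vector {} = (0 :: real ^ 'a set)" by (simp add: vec_eq_iff incidence_vector_def)
  then have "0 \<in> (incidence_vector ` bonds V E :: (real ^ 'a set) set)"
    using empty_in_bonds[OF con] by (metis image_eqI)
  moreover have "incidence_vector ` bonds V E \<subseteq> edge_space E"
    by (auto simp: bonds_def edge_space_def incidence_vector_def cut_def)
  ultimately have "facet_defining (bond_polytope V E) a b \<longleftrightarrow>
    (\<forall>x\<in>incidence_vector ` bonds V E. a \<bullet> x \<le> b) \<and> a \<noteq> 0 \<and>
    (\<forall>c\<in>edge_space E. \<forall>d. (\<forall>x\<in>incidence_vector ` bonds V E. a \<bullet> x = b \<longrightarrow> c \<bullet> x = d) \<longrightarrow>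
       (\<exists>t. c = t *\<^sub>R a \<and> d = t * b))"
    unfolding bond_polytope_def
    by (intro facet_defining_convex_hull_iff)
      (use sub a bonds_full_dimensional[OF G con] in auto)
  moreover have "(\<forall>x\<in>incidence_vector ` bonds V E. a \<bullet> x = b \<longrightarrow> c \<bullet> x = d) \<longleftrightarrow>
      (\<forall>D\<in>tight_bonds V E a b. c \<bullet> incidence_vector D = d)" for c d
    by (auto simp: tight_bonds_def)
  ultimately show ?thesis by simp
qed

section \<open>Subdividing an edge into a path\<close>

text \<open>The edge \<open>{v 0, v L}\<close> is subdivided into the path \<open>v 0, ..., v L\<close>; \<open>F\<close> consists of the
  edges common to both graphs.\<close>

locale subdivided_edge =
  fixes V :: "'a set" and F :: "'a set set" and v :: "nat \<Rightarrow> 'a" and L :: nat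
  assumes L_pos: "0 < L" and inj: "inj_on v {..L}" and v_in: "v ` {..L} \<subseteq> V"
    and F_edges: "\<And>f. f \<in> F \<Longrightarrow> f \<subseteq> V - v ` {0<..<L} \<and> card f = 2"
    and end_notin: "{v 0, v L} \<notin> F"
begin

definition e :: "nat \<Rightarrow> 'a set" where "e i = {v i, v (Suc i)}"
definition p :: "'a set" where "p = {v 0, v L}"
definition inn :: "'a set" where "inn = v ` {0<..<L}"
definition E :: "'a set set" where "E = F \<union> e ` {..<L}"
definition Eb :: "'a set set" where "Eb = insert p F"

lemma v_eq_iff: "i \<le> L \<Longrightarrow> j \<le> L \<Longrightarrow> v i = v j \<longleftrightarrow> i = j"
  using inj by (simp add: inj_on_eq_iff)

lemma v_mem_image: "i \<le> L \<Longrightarrow> J \<subseteq> {..L} \<Longrightarrow> v i \<in> v ` J \<longleftrightarrow> i \<in> J"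
  by (rule inj_on_image_mem_iff[OF inj]) auto

lemma v_inn: "i \<le> L \<Longrightarrow> v i \<in> inn \<longleftrightarrow> 0 < i \<and> i < L"
  unfolding inn_def by (subst v_mem_image) auto

lemma v_V: "i \<le> L \<Longrightarrow> v i \<in> V"
  using v_in by auto

lemma innE: assumes "x \<in> inn" obtains i where "x = v i" "0 < i" "i < L"
  using assms by (auto simp: inn_def)

lemma F_edge_V: "{x, y} \<in> F \<Longrightarrow> x \<in> V - inn \<and> y \<in> V - inn"
  using F_edges[of "{x, y}"] by (auto simp: inn_def)

lemma e_eq_iff: "i < L \<Longrightarrow> j < L \<Longrightarrow> e i = e j \<longleftrightarrow> i = j"
  unfolding e_def doubleton_eq_iff
  using v_eq_iff[of i j] v_eq_iff[of i "Suc j"] v_eq_iff[of "Suc i" j] by auto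

lemma e_notin_F:
  assumes "i < L"
  shows "e i \<notin> F"
proof
  assume "e i \<in> F"
  then have "v i \<notin> inn" "v (Suc i) \<notin> inn" using F_edge_V by (auto simp: e_def)
  \<comment> \<open>An edge avoiding all inner vertices joins the two ends, so \<open>L = 1\<close>
    and \<open>e 0\<close> is \<open>p\<close> itself.\<close>
  then have "i = 0" "Suc i = L" using assms by (auto simp: v_inn)
  then show False using \<open>e i \<in> F\<close> end_notin by (auto simp: e_def)
qed

lemma E_cases:
  assumes "{x, y} \<in> E"
  obtains "{x, y} \<in> F" | i where "i < L" "x = v i" "y = v (Suc i)"
    | i where "i < L" "x = v (Suc i)" "y = v i"
  using assms unfolding E_def e_def by (auto simp: doubleton_eq_iff)

lemma E_edge: "f \<in> E \<Longrightarrow> f \<subseteq> V \<and> card f = 2"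
  using F_edges[of f] v_V by (auto simp: E_def e_def v_eq_iff)

lemma e_in_cut: "i < L \<Longrightarrow> e i \<in> cut E S \<longleftrightarrow> (v i \<in> S) \<noteq> (v (Suc i) \<in> S)"
  unfolding e_def by (subst mem_cut_doubleton) (auto simp: v_eq_iff E_def e_def)

lemma p_in_cut: "p \<in> cut Eb S \<longleftrightarrow> (v 0 \<in> S) \<noteq> (v L \<in> S)"
  unfolding p_def using L_pos by (subst mem_cut_doubleton) (auto simp: v_eq_iff Eb_def p_def)

text \<open>Edges of \<open>F\<close> avoid the inner vertices, so they see only the part of a side
  outside \<open>inn\<close>.\<close>

lemma cut_inter_F:
  assumes "S - inn = T - inn"
  shows "cut Eb S \<inter> F = cut E T \<inter> F"
proof -
  have "f \<inter> S = f \<inter> T" if "f \<in> F" for f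
    using F_edges[OF that] assms by (auto simp: inn_def)
  then show ?thesis by (auto simp: cut_def E_def Eb_def)
qed

lemma cut_E_eq: "cut E S = cut E S \<inter> F \<union> {e i | i. i < L \<and> (v i \<in> S) \<noteq> (v (Suc i) \<in> S)}"
  using e_in_cut by (auto simp: cut_def E_def)

lemma cut_Eb_eq: "cut Eb S = cut Eb S \<inter> F \<union> (if (v 0 \<in> S) \<noteq> (v L \<in> S) then {p} else {})"
  using p_in_cut[of S] by (auto simp: cut_def Eb_def)

lemma segment_connected:
  assumes "i \<le> j" "j \<le> L" "v ` {i..j} \<subseteq> A"
  shows "(v i, v j) \<in> (adj A E)\<^sup>*"
  using assms
proof (induction j rule: dec_induct)
  case (step k)
  have "(v k, v (Suc k)) \<in> adj A E"
    using step by (auto simp: adj_iff E_def e_def image_subset_iff)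
  moreover have "(v i, v k) \<in> (adj A E)\<^sup>*"
    by (rule step.IH) (use step in auto)
  ultimately show ?case by (rule rtrancl_into_rtrancl[rotated])
qed simp

text \<open>A discrete intermediate value argument: membership in \<open>S\<close> must flip
  somewhere along the path.\<close>

lemma change_of_side:
  assumes "i \<le> j" "j \<le> L" "(v i \<in> S) \<noteq> (v j \<in> S)"
  shows "\<exists>k. i \<le> k \<and> k < j \<and> e k \<in> cut E S"
  using assms
proof (induction j rule: dec_induct)
  case (step k)
  show ?case
  proof (cases "(v i \<in> S) = (v k \<in> S)")
    case True
    then show ?thesis using step by (intro exI[of _ k]) (auto simp: e_in_cut)
  next
    case False
    then show ?thesis using step by force
  qed
qed simp

section \<open>Projecting bonds to the reduced graph\<close>

text \<open>All inner vertices in \<open>A\<close> are contracted to an end of the path lying in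
  \<open>A\<close>. A path edge then collapses or becomes \<open>p\<close>, and edges of
  \<open>F\<close> stay fixed.\<close>

lemma project_connected:
  assumes A: "A \<subseteq> V" "connected_graph A E" and ends: "A \<inter> inn \<noteq> {} \<Longrightarrow> v 0 \<in> A \<or> v L \<in> A"
  shows "connected_graph (A - inn) Eb"
proof (rule connected_graph_image[OF A(2)])
  let ?f = "\<lambda>x. if x \<in> inn then (if v 0 \<in> A then v 0 else v L) else x"
  have "v 0 \<notin> inn" "v L \<notin> inn" by (auto simp: v_inn)
  then show "?f ` A = A - inn" using ends by (force split: if_splits)
  fix x y assume xy: "x \<in> A" "y \<in> A" "{x, y} \<in> E" "?f x \<noteq> ?f y"
  have path: "?f (v i) \<in> {v 0, v L}" if "i \<le> L" for i
    using that v_inn[of i] by (cases "i = 0"; cases "i = L") auto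
  have p: "{s, t} \<in> Eb" if "s \<in> {v 0, v L}" "t \<in> {v 0, v L}" "s \<noteq> t" for s t
    using that by (auto simp: Eb_def p_def)
  from xy(3) show "{?f x, ?f y} \<in> Eb"
  proof (cases rule: E_cases)
    case 1
    then show ?thesis using F_edge_V[OF 1] by (auto simp: Eb_def)
  next
    case (2 i)
    then show ?thesis using path[of i] path[of "Suc i"] xy(4) by (intro p) auto
  next
    case (3 i)
    then show ?thesis using path[of i] path[of "Suc i"] xy(4) by (intro p) auto
  qed
qed

lemma project_graph_connected:
  "connected_graph V E \<Longrightarrow> connected_graph (V - inn) Eb"
  by (rule project_connected) (use v_V[of 0] in auto)

text \<open>Dropping the inner vertices from both sides works because each side meeting
  \<open>inn\<close> also contains an end of the path; \<open>p\<close> is cut iff the ends are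
  separated, which one path edge achieves.\<close>

lemma project_bond:
  assumes D: "D \<in> bonds V E" and one: "\<And>j k. j < k \<Longrightarrow> k < L \<Longrightarrow> e j \<in> D \<Longrightarrow> e k \<notin> D"
  shows "D \<inter> F \<union> (if \<exists>k<L. e k \<in> D then {p} else {}) \<in> bonds (V - inn) Eb"
proof -
  obtain S where S: "S \<subseteq> V" "D = cut E S" "connected_graph S E" "connected_graph (V - S) E"
    using D by (auto simp: bonds_iff)
  \<comment> \<open>A side with an inner vertex but neither end would force a cut edge on the path
    both before and after that vertex. Stated for any \<open>A\<close> so as to cover
    \<open>S\<close> and \<open>V - S\<close>.\<close>
  have ends: "v 0 \<in> A \<or> v L \<in> A" if A: "cut E A = D" and x: "A \<inter> inn \<noteq> {}" for A
  proof (rule ccontr)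
    assume c: "\<not> ?thesis"
    obtain i where i: "v i \<in> A" "0 < i" "i < L" using x innE by blast
    obtain j where j: "j < i" "e j \<in> D"
      using change_of_side[of 0 i A] A c i by auto
    obtain k where k: "i \<le> k" "k < L" "e k \<in> D"
      using change_of_side[of i L A] A c i by auto
    show False using one[of j k] j k by auto
  qed
  have comp: "cut E (V - S) = D" using cut_complement[of E V S] E_edge S(2) by auto
  have 1: "connected_graph (S - inn) Eb"
    by (rule project_connected) (use S ends[of S] in auto)
  have "connected_graph ((V - S) - inn) Eb"
    by (rule project_connected) (use S ends[OF comp] in auto)
  then have 2: "connected_graph ((V - inn) - (S - inn)) Eb"
    by (rule back_subst[of "\<lambda>A. connected_graph A Eb"]) auto
  \<comment> \<open>If \<open>e k\<close> is the only cut edge of the path, the vertices up to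
    \<open>v k\<close> lie on one side and those from \<open>v (Suc k)\<close> on lie on the
    other.\<close>
  have "(v 0 \<in> S) \<noteq> (v L \<in> S) \<longleftrightarrow> (\<exists>k<L. e k \<in> D)"
  proof
    assume "(v 0 \<in> S) \<noteq> (v L \<in> S)"
    then show "\<exists>k<L. e k \<in> D" using change_of_side[of 0 L S] S(2) by auto
  next
    assume "\<exists>k<L. e k \<in> D"
    then obtain k where k: "k < L" "e k \<in> D" by blast
    have "(v 0 \<in> S) = (v k \<in> S)"
    proof (rule ccontr)
      assume "\<not> ?thesis"
      then obtain j where "j < k" "e j \<in> D" using change_of_side[of 0 k S] k S(2) by auto
      then show False using one k by blast
    qed
    moreover have "(v (Suc k) \<in> S) = (v L \<in> S)"
    proof (rule ccontr)
      assume "\<not> ?thesis"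
      then obtain j where "Suc k \<le> j" "j < L" "e j \<in> D"
        using change_of_side[of "Suc k" L S] k S(2) by auto
      then show False using one[of k j] k by auto
    qed
    ultimately show "(v 0 \<in> S) \<noteq> (v L \<in> S)" using k e_in_cut S(2) by auto
  qed
  moreover have "v 0 \<notin> inn" "v L \<notin> inn" by (auto simp: v_inn)
  moreover have "cut Eb (S - inn) \<inter> F = D \<inter> F" using cut_inter_F[of "S - inn" S] S(2) by auto
  ultimately have "cut Eb (S - inn) = D \<inter> F \<union> (if \<exists>k<L. e k \<in> D then {p} else {})"
    using cut_Eb_eq[of "S - inn"] by auto
  then show ?thesis using 1 2 S(1) unfolding bonds_iff by (intro exI[of _ "S - inn"]) auto
qed

section \<open>Lifting bonds from the reduced graph\<close>

text \<open>Inner vertices up to index \<open>k\<close> follow \<open>v 0\<close>, later ones follow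
  \<open>v L\<close>, so \<open>e k\<close> is the only path edge that can be cut.\<close>

definition lift :: "nat \<Rightarrow> 'a set \<Rightarrow> 'a set" where
  "lift k A = A \<union> {v i | i. 0 < i \<and> i < L \<and> (if i \<le> k then v 0 \<in> A else v L \<in> A)}"

text \<open>By \<open>k < L\<close> the rule also covers the ends: index 0 falls under the first
  case and index \<open>L\<close> under the second.\<close>

lemma v_in_lift:
  assumes "k < L" "A \<subseteq> V - inn" "i \<le> L"
  shows "v i \<in> lift k A \<longleftrightarrow> (if i \<le> k then v 0 \<in> A else v L \<in> A)"
proof -
  have "v i \<notin> A" if "0 < i" "i < L" using that assms v_inn[of i] by auto
  moreover have *: "v i \<in> {v i | i. 0 < i \<and> i < L \<and> (if i \<le> k then v 0 \<in> A else v L \<in> A)} \<longleftrightarrow>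
      0 < i \<and> i < L \<and> (if i \<le> k then v 0 \<in> A else v L \<in> A)"
    using assms(3) by (auto simp: v_eq_iff)
  ultimately show ?thesis using assms(1,3)
    unfolding lift_def Un_iff * by (cases "i = 0"; cases "i = L") auto
qed

text \<open>If \<open>A\<close> contains both ends, the whole path lies in the lift and replaces
  \<open>p\<close>; each added inner vertex reaches its end along the path.\<close>

lemma lift_connected:
  assumes k: "k < L" and A: "A \<subseteq> V - inn" "connected_graph A Eb"
  shows "connected_graph (lift k A) E"
proof (rule connected_graph_extend[OF A(2)])
  fix x y assume xy: "x \<in> A" "y \<in> A" "{x, y} \<in> Eb"
  show "(x, y) \<in> (adj (lift k A) E)\<^sup>*"
  proof (cases "{x, y} \<in> F")
    case True
    then show ?thesis using xy by (auto simp: adj_iff lift_def E_def)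
  next
    case False
    then have xy': "x = v 0 \<and> y = v L \<or> x = v L \<and> y = v 0"
      using xy by (auto simp: Eb_def p_def doubleton_eq_iff)
    have "v ` {0..L} \<subseteq> lift k A" using xy xy' v_in_lift[OF k A(1)] by (auto split: if_splits)
    then have "(v 0, v L) \<in> (adj (lift k A) E)\<^sup>*" by (intro segment_connected) auto
    then show ?thesis using xy' adj_rtrancl_sym[of "v 0" "v L"] by auto
  qed
next
  fix x assume x: "x \<in> lift k A"
  show "\<exists>y\<in>A. (x, y) \<in> (adj (lift k A) E)\<^sup>*"
  proof (cases "x \<in> A")
    case False
    then obtain i where i: "x = v i" "0 < i" "i < L" "if i \<le> k then v 0 \<in> A else v L \<in> A"
      using x by (auto simp: lift_def)
    show ?thesis
    proof (cases "i \<le> k")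
      case True
      have "v ` {0..i} \<subseteq> lift k A" using i True v_in_lift[OF k A(1)] by auto
      then have "(v 0, x) \<in> (adj (lift k A) E)\<^sup>*"
        unfolding i(1) using i by (intro segment_connected) auto
      then show ?thesis using i True adj_rtrancl_sym[of "v 0" x] by auto
    next
      case False
      have "v ` {i..L} \<subseteq> lift k A" using i False v_in_lift[OF k A(1)] by auto
      then have "(x, v L) \<in> (adj (lift k A) E)\<^sup>*"
        unfolding i(1) using i by (intro segment_connected) auto
      then show ?thesis using i False by auto
    qed
  qed auto
qed

text \<open>Lifting with a fixed \<open>k\<close> commutes with complements, so both sides stay
  connected. Since \<open>k\<close> is arbitrary, \<open>p\<close> may be exchanged for any path
  edge.\<close>

lemma lift_bond:
  assumes D: "D \<in> bonds (V - inn) Eb" and k: "k < L"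
  shows "D \<inter> F \<union> (if p \<in> D then {e k} else {}) \<in> bonds V E"
proof -
  obtain S where S: "S \<subseteq> V - inn" "D = cut Eb S" "connected_graph S Eb"
      "connected_graph (V - inn - S) Eb"
    using D by (auto simp: bonds_iff)
  have sub: "lift k S \<subseteq> V" using S(1) v_V by (auto simp: lift_def)
  have "V - lift k S = lift k (V - inn - S)"
  proof (rule set_eqI)
    fix x
    show "x \<in> V - lift k S \<longleftrightarrow> x \<in> lift k (V - inn - S)"
    proof (cases "x \<in> inn")
      case True
      then obtain i where i: "x = v i" "0 < i" "i < L" by (rule innE)
      have "v 0 \<in> V - inn" "v L \<in> V - inn" by (auto simp: v_V v_inn)
      then show ?thesis
        using i v_V[of i] v_in_lift[OF k S(1), of i] v_in_lift[OF k, of "V - inn - S" i] by auto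
    next
      case False
      have "x \<in> lift k B \<longleftrightarrow> x \<in> B" for B using False by (auto simp: lift_def v_inn)
      then show ?thesis using False by auto
    qed
  qed
  then have con: "connected_graph (lift k S) E" "connected_graph (V - lift k S) E"
    using lift_connected[OF k] S by auto
  have "S - inn = lift k S - inn" by (auto simp: lift_def v_inn)
  then have "cut E (lift k S) \<inter> F = D \<inter> F" using cut_inter_F S(2) by auto
  moreover have "{e i | i. i < L \<and> (v i \<in> lift k S) \<noteq> (v (Suc i) \<in> lift k S)}
      = (if p \<in> D then {e k} else {})"
  proof -
    have "i < L \<and> (v i \<in> lift k S) \<noteq> (v (Suc i) \<in> lift k S) \<longleftrightarrow> i = k \<and> p \<in> D" for i
      using k v_in_lift[OF k S(1), of i] v_in_lift[OF k S(1), of "Suc i"] p_in_cut[of S] S(2)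
      by (cases i k rule: linorder_cases) auto
    then show ?thesis by auto
  qed
  ultimately have "cut E (lift k S) = D \<inter> F \<union> (if p \<in> D then {e k} else {})"
    using cut_E_eq[of "lift k S"] by simp
  then show ?thesis using con sub unfolding bonds_iff by (intro exI[of _ "lift k S"]) auto
qed

section \<open>Bonds containing two path edges\<close>

lemma cut_segment:
  assumes "j < k" "k < L"
  shows "cut E (v ` {Suc j..k}) = {e j, e k}"
proof -
  have seg: "v i \<in> v ` {Suc j..k} \<longleftrightarrow> j < i \<and> i \<le> k" if "i \<le> L" for i
    using that assms by (subst v_mem_image) auto
  have "v ` {Suc j..k} \<subseteq> inn" using assms by (auto simp: v_inn)
  then have "f \<inter> v ` {Suc j..k} = {}" if "f \<in> F" for f
    using F_edges[OF that] by (auto simp: inn_def)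
  then have "cut E (v ` {Suc j..k}) \<inter> F = {}" by (auto simp: cut_def)
  moreover have "i < L \<and> (v i \<in> v ` {Suc j..k}) \<noteq> (v (Suc i) \<in> v ` {Suc j..k}) \<longleftrightarrow> i = j \<or> i = k"
    for i
    using assms seg[of i] seg[of "Suc i"] by (cases "i < L") auto
  then have "{e i | i. i < L \<and> (v i \<in> v ` {Suc j..k}) \<noteq> (v (Suc i) \<in> v ` {Suc j..k})} = {e j, e k}"
    by auto
  ultimately show ?thesis using cut_E_eq[of "v ` {Suc j..k}"] by simp
qed

text \<open>The segment between two consecutive cut edges of the path has no neighbours on its own side
  of the bond, so it is that side.\<close>

lemma double_bond_side:
  assumes D: "D \<in> bonds V E" and jk: "j < k" "k < L" "e j \<in> D" "e k \<in> D"
  shows "\<exists>j k. j < k \<and> k < L \<and> D = {e j, e k} \<and> connected_graph (V - v ` {Suc j..k}) E"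
proof -
  \<comment> \<open>The given \<open>k\<close> is replaced by the next cut edge after
    \<open>e j\<close>, so no path edge strictly between is cut.\<close>
  obtain k where k: "j < k" "k < L" "e k \<in> D" and least: "\<And>i. j < i \<Longrightarrow> i < k \<Longrightarrow> e i \<notin> D"
  proof -
    have "\<exists>k. j < k \<and> k < L \<and> e k \<in> D" using jk by blast
    then obtain k where "j < k \<and> k < L \<and> e k \<in> D"
        "\<forall>i<k. \<not> (j < i \<and> i < L \<and> e i \<in> D)"
      by (subst (asm) exists_least_iff) blast
    then show thesis by (intro that[of k]) auto
  qed
  let ?T = "v ` {Suc j..k}"
  obtain S0 where S0: "S0 \<subseteq> V" "D = cut E S0" "connected_graph S0 E" "connected_graph (V - S0) E"
    using D by (auto simp: bonds_iff)
  have compl: "cut E (V - S0) = D" using cut_complement[of E V S0] E_edge S0(2) by auto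
  \<comment> \<open>\<open>S\<close> is the side containing the segment; complementing does not
    change the cut.\<close>
  define S where "S = (if v k \<in> S0 then S0 else V - S0)"
  have S: "S \<subseteq> V" "D = cut E S" "connected_graph S E" "connected_graph (V - S) E" "v k \<in> S"
    using S0 compl v_V[of k] k by (auto simp: S_def double_diff)
  have mid: "v i \<in> S" if i: "j < i" "i \<le> k" for i
  proof (rule ccontr)
    assume "v i \<notin> S"
    then obtain l where "i \<le> l" "l < k" "e l \<in> D"
      using change_of_side[of i k S] S i k by auto
    then show False using least[of l] i by auto
  qed
  have out: "v j \<notin> S" "v (Suc k) \<notin> S"
    using e_in_cut[of j S] e_in_cut[of k S] mid[of "Suc j"] k jk S by auto
  \<comment> \<open>Vertices of the segment are inner, so their only neighbours are on the path, and
    \<open>v j\<close> and \<open>v (Suc k)\<close> lie on the other side.\<close>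
  have closed: "y \<in> ?T" if x: "x \<in> ?T" and y: "y \<in> S" and xy: "{x, y} \<in> E" for x y
  proof -
    obtain m where m: "x = v m" "j < m" "m \<le> k" using x by auto
    then have "x \<in> inn" using k by (auto simp: v_inn)
    from xy show ?thesis
    proof (cases rule: E_cases)
      case 1
      then show ?thesis using F_edge_V[OF 1] \<open>x \<in> inn\<close> by auto
    next
      case (2 i)
      then have "i = m" using m k v_eq_iff[of i m] by auto
      then show ?thesis using 2 m y out by (cases "m = k") auto
    next
      case (3 i)
      then have "Suc i = m" using m k v_eq_iff[of "Suc i" m] by auto
      then show ?thesis using 3 m y out by (cases "i = j") auto
    qed
  qed
  have "S \<subseteq> ?T"
  proof
    fix y assume "y \<in> S"
    then have "(v k, y) \<in> (adj S E)\<^sup>*" using S by (auto simp: connected_graph_adj)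
    then show "y \<in> ?T"
    proof (induction rule: rtrancl_induct)
      case base
      then show ?case using k by auto
    next
      case (step y z)
      then show ?case using closed[of y z] by (auto simp: adj_iff)
    qed
  qed
  moreover have "?T \<subseteq> S" using mid by auto
  ultimately have "S = ?T" by blast
  then show ?thesis using S k cut_segment by auto
qed

text \<open>Deleting an inner segment leaves the graph \<open>(V - inn, F)\<close> with two path
  pieces hanging from its ends. Connectivity therefore does not depend on the chosen
  segment.\<close>

lemma double_bonds:
  assumes con: "connected_graph (V - v ` {Suc j..k}) E" and jk: "j < k" "k < L"
    and jk': "j' < k'" "k' < L"
  shows "{e j', e k'} \<in> bonds V E"
proof -
  have cF: "connected_graph (V - inn) F"
  proof (rule connected_graph_image[OF con])
    \<comment> \<open>The two remaining path pieces are contracted to \<open>v 0\<close> and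
      \<open>v L\<close>.\<close>
    let ?f = "\<lambda>x. if x \<in> v ` {..j} then v 0 else if x \<in> v ` {Suc k..L} then v L else x"
    have f1: "?f (v i) = v 0" if "i \<le> j" for i using that by auto
    have f2: "?f (v i) = v L" if "k < i" "i \<le> L" for i
    proof -
      have "v i \<notin> v ` {..j}" using that jk by (subst v_mem_image) auto
      then show ?thesis using that by auto
    qed
    have f3: "?f x = x" if "x \<notin> inn" for x
    proof -
      have "x = v 0" if "x \<in> v ` {..j}" using that \<open>x \<notin> inn\<close> jk by (auto simp: v_inn)
      moreover have "x = v L" if "x \<in> v ` {Suc k..L}"
        using that \<open>x \<notin> inn\<close> jk by (auto simp: v_inn dest!: le_neq_implies_less)
      ultimately show ?thesis by auto
    qed
    have seg: "v i \<in> v ` {Suc j..k} \<longleftrightarrow> j < i \<and> i \<le> k" if "i \<le> L" for i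
      using that jk by (subst v_mem_image) auto
    have ends: "v 0 \<in> V - inn" "v L \<in> V - inn" by (auto simp: v_V v_inn)
    show "?f ` (V - v ` {Suc j..k}) = V - inn"
    proof
      show "?f ` (V - v ` {Suc j..k}) \<subseteq> V - inn"
      proof (rule image_subsetI)
        fix x assume x: "x \<in> V - v ` {Suc j..k}"
        show "?f x \<in> V - inn"
        proof (cases "x \<in> inn")
          case True
          then obtain i where i: "x = v i" "0 < i" "i < L" by (rule innE)
          then have "i \<le> j \<or> k < i" using x seg[of i] by auto
          then show ?thesis using f1[of i] f2[of i] i ends by auto
        next
          case False
          then show ?thesis using f3[OF False] x by auto
        qed
      qed
      have "v ` {Suc j..k} \<subseteq> inn" using jk by (auto simp: v_inn)
      then have "x \<in> V - v ` {Suc j..k}" if "x \<in> V - inn" for x using that by auto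
      then show "V - inn \<subseteq> ?f ` (V - v ` {Suc j..k})"
        by (intro subsetI, rule_tac x = x in image_eqI) (use f3 in auto)
    qed
    have same: "?f (v i) = ?f (v (Suc i))"
      if "i < L" "v i \<notin> v ` {Suc j..k}" "v (Suc i) \<notin> v ` {Suc j..k}" for i
    proof -
      have "Suc i \<le> j \<or> k < i" using that seg[of i] seg[of "Suc i"] jk by auto
      then show ?thesis
      proof
        assume "Suc i \<le> j"
        then show ?thesis using f1[of i] f1[of "Suc i"] by simp
      next
        assume "k < i"
        then show ?thesis using f2[of i] f2[of "Suc i"] that(1) by simp
      qed
    qed
    fix x y assume xy: "x \<in> V - v ` {Suc j..k}" "y \<in> V - v ` {Suc j..k}" "{x, y} \<in> E" "?f x \<noteq> ?f y"
    from xy(3) show "{?f x, ?f y} \<in> F"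
    proof (cases rule: E_cases)
      case 1
      then show ?thesis using F_edge_V[OF 1] f3[of x] f3[of y] by auto
    next
      case (2 i)
      then show ?thesis using same[of i] xy by auto
    next
      case (3 i)
      then show ?thesis using same[of i] xy by auto
    qed
  qed
  let ?T = "v ` {Suc j'..k'}"
  have T: "?T \<subseteq> inn" using jk' by (auto simp: v_inn)
  have seg: "v i \<in> ?T \<longleftrightarrow> j' < i \<and> i \<le> k'" if "i \<le> L" for i
    using that jk' by (subst v_mem_image) auto
  have c1: "connected_graph (V - ?T) E"
  proof (rule connected_graph_extend[OF cF])
    fix x y assume "x \<in> V - inn" "y \<in> V - inn" "{x, y} \<in> F"
    then show "(x, y) \<in> (adj (V - ?T) E)\<^sup>*" 
      using T by (intro r_into_rtrancl) (auto simp: adj_iff E_def)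
  next
    fix x assume x: "x \<in> V - ?T"
    show "\<exists>y\<in>V - inn. (x, y) \<in> (adj (V - ?T) E)\<^sup>*"
    proof (cases "x \<in> inn")
      case True
      then obtain i where i: "x = v i" "0 < i" "i < L" by (rule innE)
      then have "i \<le> j' \<or> k' < i" using x seg[of i] by auto
      then show ?thesis
      proof
        assume "i \<le> j'"
        then have "v ` {0..i} \<subseteq> V - ?T"
          using i jk' by (intro image_subsetI) (simp add: seg v_V)
        then have "(v 0, v i) \<in> (adj (V - ?T) E)\<^sup>*"
          using i by (intro segment_connected) auto
        then show ?thesis using i adj_rtrancl_sym[of "v 0" "v i"] v_V[of 0] v_inn[of 0] by auto
      next
        assume "k' < i"
        then have "v ` {i..L} \<subseteq> V - ?T"
          using i jk' by (intro image_subsetI) (simp add: seg v_V)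
        then have "(v i, v L) \<in> (adj (V - ?T) E)\<^sup>*"
          using i by (intro segment_connected) auto
        then show ?thesis using i v_V[of L] v_inn[of L] by auto
      qed
    qed (use x in auto)
  qed
  have c2: "connected_graph ?T E"
    unfolding connected_graph_adj
  proof (intro ballI)
    fix x y assume "x \<in> ?T" "y \<in> ?T"
    then obtain i l where il: "x = v i" "y = v l" "Suc j' \<le> i" "i \<le> k'" "Suc j' \<le> l" "l \<le> k'"
      by auto
    show "(x, y) \<in> (adj ?T E)\<^sup>*"
    proof (cases "i \<le> l")
      case True
      then show ?thesis unfolding il using il jk' by (intro segment_connected) auto
    next
      case False
      then have "(v l, v i) \<in> (adj ?T E)\<^sup>*" using il jk' by (intro segment_connected) auto
      then show ?thesis unfolding il by (rule adj_rtrancl_sym)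
    qed
  qed
  have "?T \<subseteq> V" using jk' by (auto simp: v_V)
  then show ?thesis
    unfolding bonds_iff using c1 c2 cut_segment[OF jk'] by (intro exI[of _ ?T]) auto
qed

end

theorem theorem4p8:
  fixes V Vbar :: "'a::finite set" and E Ebar :: "'a set set"
    and a abar :: "real ^ ('a set)" and b :: real and P :: "'a list"
  assumes "simple_graph V E" and "connected_graph V E"
    and "a \<in> edge_space E"
    and "facet_defining (bond_polytope V E) a b"
    and "induced_path V E P" and "2 \<le> length P"
    and "\<forall>e\<in>path_edges P.
           {x \<in> edge_space E. a \<bullet> x \<le> b} \<noteq> {x \<in> edge_space E. - (x $ e) \<le> 0}"
    and "(\<exists>e\<in>path_edges P. \<exists>f\<in>path_edges P. a $ e \<noteq> a $ f)
         \<or> \<not> (\<exists>D\<in>tight_bonds V E a b. card (D \<inter> path_edges P) = 2)"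
    and "Vbar = replace_path_vertices V P" and "Ebar = replace_path_edges E P"
    and "simple_graph Vbar Ebar"
    and "abar \<in> edge_space Ebar"
    and "\<forall>e\<in>Ebar \<inter> E. abar $ e = a $ e"
    and "abar $ end_edge P = Max ((\<lambda>e. a $ e) ` path_edges P)"
  shows "facet_defining (bond_polytope Vbar Ebar) abar b"
proof -
  note G = assms(1) and con = assms(2) and aE = assms(3) and facet = assms(4)
    and nontriv = assms(7) and Gbar = assms(11) and abarE = assms(12)

  \<comment> \<open>The given path as a subdivided edge\<close>
  define L where "L = length P - 1"
  define F where "F = E - path_edges P"
  define e where "e i = {P ! i, P ! Suc i}" for i
  define p where "p = end_edge P"
  have dist: "distinct P" and sub: "set P \<subseteq> V" and PE: "path_edges P \<subseteq> E" and Pne: "P \<noteq> []"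
    and ind: "induced_edges E (set P) = path_edges P"
    using assms(5) by (auto simp: induced_path_def is_path_def)
  have L0: "0 < L" and len: "length P = Suc L" using assms(6) by (auto simp: L_def)
  have hdl: "hd P = P ! 0" "last P = P ! L"
    using Pne by (auto simp: hd_conv_nth last_conv_nth L_def)
  have nth_eq: "P ! i = P ! j \<longleftrightarrow> i = j" if "i \<le> L" "j \<le> L" for i j
    using dist len that by (simp add: nth_eq_iff_index_eq)
  have setP: "set P = (!) P ` {..L}"
    using len by (auto simp: set_conv_nth less_Suc_eq_le)
  have inner: "inner_vertices P = (!) P ` {0<..<L}"
  proof
    show "inner_vertices P \<subseteq> (!) P ` {0<..<L}"
    proof
      fix x assume "x \<in> inner_vertices P"
      then obtain i where i: "i \<le> L" "x = P ! i" "x \<noteq> P ! 0" "x \<noteq> P ! L"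
        by (auto simp: inner_vertices_def setP hdl)
      then have "i \<in> {0<..<L}" by (cases "i = 0"; cases "i = L") auto
      then show "x \<in> (!) P ` {0<..<L}" using i by blast
    qed
    show "(!) P ` {0<..<L} \<subseteq> inner_vertices P"
      by (auto simp: inner_vertices_def setP hdl nth_eq)
  qed
  have pathe: "path_edges P = e ` {..<L}"
    by (auto simp: path_edges_def e_def len)
  have Ebar_eq: "Ebar = insert p F" using assms(10) by (simp add: replace_path_edges_def p_def F_def)
  have Vbar_eq: "Vbar = V - (!) P ` {0<..<L}"
    using assms(9) by (simp add: replace_path_vertices_def inner)
  have p_eq: "p = {P ! 0, P ! L}" by (simp add: p_def end_edge_def hdl)
  \<comment> \<open>As \<open>P\<close> is induced, an edge joining its ends is a path edge, which
    \<open>F\<close> excludes.\<close>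
  have pF: "p \<notin> F"
  proof
    assume "p \<in> F"
    moreover have "p \<subseteq> set P" using p_eq setP by auto
    ultimately show False using ind by (auto simp: F_def induced_edges_def)
  qed
  \<comment> \<open>Edges of \<open>F\<close> avoid the inner vertices because the reduced pair is a
    graph.\<close>
  interpret S: subdivided_edge V F "(!) P" L
  proof
    show "f \<subseteq> V - (!) P ` {0<..<L} \<and> card f = 2" if "f \<in> F" for f
      using Gbar that by (auto simp: simple_graph_def Ebar_eq Vbar_eq)
  qed (use L0 pF p_eq sub setP nth_eq in \<open>auto simp: inj_on_def\<close>)
  have Se: "S.e = e" by (rule ext) (simp add: S.e_def e_def)
  have Sp: "S.p = p" by (simp add: S.p_def p_eq)
  have SE: "S.E = E" using PE unfolding S.E_def Se by (auto simp: F_def pathe)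
  have SEb: "S.Eb = Ebar" by (simp add: S.Eb_def Sp Ebar_eq)
  have SV: "V - S.inn = Vbar" by (simp add: S.inn_def Vbar_eq)
  note S_eqs = Se Sp SE SEb SV
  note e_eq_iff = S.e_eq_iff[unfolded S_eqs] and e_notin_F = S.e_notin_F[unfolded S_eqs]
    and project_bond = S.project_bond[unfolded S_eqs] and lift_bond = S.lift_bond[unfolded S_eqs]
    and double_bond_side = S.double_bond_side[unfolded S_eqs]
    and double_bonds = S.double_bonds[unfolded S_eqs]
  have conb: "connected_graph Vbar Ebar"
    using S.project_graph_connected con by (simp add: S_eqs)

  \<comment> \<open>Validity of the new inequality\<close>
  define M where "M = abar $ p"
  have M: "M = Max ((\<lambda>e. a $ e) ` e ` {..<L})"
    using assms(14) by (simp add: M_def p_def pathe)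
  have M_ge: "a $ e i \<le> M" if "i < L" for i
    unfolding M using that by (intro Max_ge) auto
  have "M \<in> (\<lambda>e. a $ e) ` e ` {..<L}"
    unfolding M using L0 by (intro Max_in) auto
  then obtain k0 where k0: "k0 < L" "a $ e k0 = M" by auto
  have abF: "abar $ f = a $ f" if "f \<in> F" for f
    using assms(13) that by (auto simp: Ebar_eq F_def)

  note facet' = facet[unfolded facet_defining_bond_polytope_iff[OF G con aE]]
  have valid: "a \<bullet> incidence_vector D \<le> b" if "D \<in> bonds V E" for D
    using facet' that by blast
  have a0: "a \<noteq> 0" using facet' by blast
  have uniq: "\<exists>t. c = t *\<^sub>R a \<and> d = t * b"
    if "c \<in> edge_space E" "\<And>D. D \<in> tight_bonds V E a b \<Longrightarrow> c \<bullet> incidence_vector D = d" for c d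
    by (rule facet'[THEN conjunct2, THEN conjunct2, rule_format]) (fact that)+

  have inc_F: "c \<bullet> incidence_vector (D \<inter> F \<union> {f}) = c $ f + (\<Sum>g\<in>D \<inter> F. c $ g)"
    if "f \<notin> F" for c :: "real ^ ('a set)" and D f
    using that by (simp add: inner_incidence_vector)
  have bar_split: "D = D \<inter> F \<union> (if p \<in> D then {p} else {})" if "D \<in> bonds Vbar Ebar" for D
    using that by (auto simp: bonds_def cut_def Ebar_eq)
  have split: "D = D \<inter> F \<union> {f \<in> e ` {..<L}. f \<in> D}" if "D \<in> bonds V E" for D
    using that by (auto simp: bonds_def cut_def F_def pathe)

  \<comment> \<open>\<open>D\<close> is lifted with \<open>p\<close> replaced by
    \<open>e k0\<close>, whose coefficient is also \<open>M\<close>, so the value is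
    unchanged.\<close>
  have validb: "abar \<bullet> incidence_vector D \<le> b" if D: "D \<in> bonds Vbar Ebar" for D
  proof (cases "p \<in> D")
    case True
    have "a \<bullet> incidence_vector (D \<inter> F \<union> {e k0}) \<le> b"
      using valid[OF lift_bond[OF D k0(1)]] True by simp
    moreover have "D = D \<inter> F \<union> {p}" using bar_split[OF D] True by simp
    from inc_F[OF pF, of abar D, folded this]
    have "abar \<bullet> incidence_vector D = M + (\<Sum>g\<in>D \<inter> F. abar $ g)" by (simp add: M_def)
    ultimately show ?thesis
      using inc_F[OF e_notin_F[OF k0(1)], of a D] k0 abF by simp
  next
    case False
    then have D': "D = D \<inter> F" using bar_split[OF D] by simp
    then have "a \<bullet> incidence_vector D \<le> b"
      using valid[OF lift_bond[OF D k0(1)]] False by simp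
    moreover have "abar \<bullet> incidence_vector D = a \<bullet> incidence_vector D"
      unfolding inner_incidence_vector using D' abF by (intro sum.cong) auto
    ultimately show ?thesis by simp
  qed

  \<comment> \<open>Tight bonds by their number of path edges\<close>
  define single where "single D \<longleftrightarrow> (\<forall>j k. j < k \<longrightarrow> k < L \<longrightarrow> e j \<in> D \<longrightarrow> e k \<notin> D)" for D
  have single_none: "D \<in> tight_bonds Vbar Ebar abar b" "D \<subseteq> F"
    if D: "D \<in> tight_bonds V E a b" and no: "\<And>i. i < L \<Longrightarrow> e i \<notin> D" for D
  proof -
    have DB: "D \<in> bonds V E" using D by (simp add: tight_bonds_def)
    show DF: "D \<subseteq> F" using split[OF DB] no by auto
    have "D \<inter> F \<union> (if \<exists>k<L. e k \<in> D then {p} else {}) \<in> bonds Vbar Ebar"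
      by (rule project_bond[OF DB]) (use no in auto)
    moreover have "\<not> (\<exists>k<L. e k \<in> D)" using no by blast
    ultimately have "D \<in> bonds Vbar Ebar" using DF by (simp add: Int_absorb2)
    moreover have "abar \<bullet> incidence_vector D = a \<bullet> incidence_vector D"
      unfolding inner_incidence_vector using DF abF by (intro sum.cong) auto
    ultimately show "D \<in> tight_bonds Vbar Ebar abar b"
      using D by (simp add: tight_bonds_def)
  qed
  have single_one: "D \<inter> F \<union> {p} \<in> tight_bonds Vbar Ebar abar b" "D = D \<inter> F \<union> {e i}" "a $ e i = M"
    if D: "D \<in> tight_bonds V E a b" and s: "single D" and i: "i < L" "e i \<in> D" for D i
  proof -
    have DB: "D \<in> bonds V E" using D by (simp add: tight_bonds_def)
    have "j = i" if "j < L" "e j \<in> D" for j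
      using that s i unfolding single_def by (metis linorder_neqE_nat)
    then have "{f \<in> e ` {..<L}. f \<in> D} = {e i}" using i by blast
    then show D': "D = D \<inter> F \<union> {e i}" by (metis split[OF DB])
    have "D \<inter> F \<union> (if \<exists>k<L. e k \<in> D then {p} else {}) \<in> bonds Vbar Ebar"
      by (rule project_bond[OF DB]) (use s in \<open>auto simp: single_def\<close>)
    moreover have "\<exists>k<L. e k \<in> D" using i by blast
    ultimately have Db: "D \<inter> F \<union> {p} \<in> bonds Vbar Ebar" by simp
    have "a $ e i + (\<Sum>g\<in>D \<inter> F. a $ g) = b"
      using inc_F[OF e_notin_F[OF i(1)], of a D, folded D'] D by (simp add: tight_bonds_def)
    moreover have ab: "abar \<bullet> incidence_vector (D \<inter> F \<union> {p}) = M + (\<Sum>g\<in>D \<inter> F. a $ g)"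
      using inc_F[OF pF, of abar D] abF by (simp add: M_def)
    \<comment> \<open>Exchanging \<open>e i\<close> for \<open>p\<close> changes the value from
      \<open>b\<close> to \<open>b + M - a $ e i\<close>; validity gives
      \<open>M \<le> a $ e i\<close>.\<close>
    ultimately show aM: "a $ e i = M" using validb[OF Db] M_ge[OF i(1)] by simp
    then show "D \<inter> F \<union> {p} \<in> tight_bonds Vbar Ebar abar b"
      using Db ab \<open>a $ e i + _ = b\<close> by (simp add: tight_bonds_def)
  qed
  \<comment> \<open>One bond with two path edges makes every pair of path edges a bond, and validity
    bounds the sum of each pair.\<close>
  have double: "\<exists>j k. j < k \<and> k < L \<and> D = {e j, e k} \<and> (\<forall>i l. i < l \<longrightarrow> l < L \<longrightarrow> a $ e i + a $ e l \<le> b)"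
    if D: "D \<in> bonds V E" and s: "\<not> single D" for D
  proof -
    obtain j k where jk: "j < k" "k < L" "D = {e j, e k}"
        "connected_graph (V - (!) P ` {Suc j..k}) E"
      using s double_bond_side[OF D] unfolding single_def by blast
    have "a $ e i + a $ e l \<le> b" if il: "i < l" "l < L" for i l
    proof -
      have "{e i, e l} \<in> bonds V E" by (rule double_bonds[OF jk(4) jk(1,2) il])
      moreover have "e i \<noteq> e l" using il e_eq_iff[of i l] by simp
      ultimately show ?thesis using valid[of "{e i, e l}"] by (simp add: inner_incidence_vector)
    qed
    then show ?thesis using jk by blast
  qed

  \<comment> \<open>The coefficients on the path\<close>
  \<comment> \<open>Otherwise every tight bond satisfies \<open>x $ e i = 0\<close>, so this
    equation is a multiple of \<open>a \<bullet> x = b\<close>. Validity at a bond containing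
    \<open>e i\<close> fixes the sign and yields the excluded inequality.\<close>
  have ex_tight: "\<exists>D\<in>tight_bonds V E a b. e i \<in> D" if i: "i < L" for i
  proof (rule ccontr)
    assume no: "\<not> ?thesis"
    have eE: "e i \<in> E" using i PE pathe by auto
    let ?x = "incidence_vector {e i} :: real ^ ('a set)"
    have xE: "?x \<in> edge_space E" using eE by (auto simp: edge_space_def incidence_vector_def)
    have x_inner: "?x \<bullet> incidence_vector D = (if e i \<in> D then 1 else 0)" for D
      by (simp add: inner_commute[of ?x] inner_incidence_vector) (simp add: incidence_vector_def)
    obtain t where t: "?x = t *\<^sub>R a" "0 = t * b"
      using uniq[OF xE, of 0] no x_inner by auto
    have "?x \<noteq> 0" by (auto simp: vec_eq_iff incidence_vector_def)
    then have t0: "t \<noteq> 0" and b0: "b = 0" using t by auto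
    obtain D where D: "D \<in> bonds V E" "e i \<in> D"
      using bonds_full_dimensional[OF G con xE] \<open>?x \<noteq> 0\<close> x_inner by fastforce
    have ax: "a = inverse t *\<^sub>R ?x" using t t0 by simp
    have "a \<bullet> incidence_vector D = inverse t"
      by (subst ax) (use D x_inner[of D] in simp)
    then have "inverse t \<le> 0" using valid[OF D(1)] b0 by simp
    then have tneg: "inverse t < 0" using t0 by (simp add: less_le)
    have "a \<bullet> x = inverse t * x $ e i" for x
      by (subst ax) (simp add: inner_commute[of ?x] inner_incidence_vector)
    then have "a \<bullet> x \<le> b \<longleftrightarrow> - (x $ e i) \<le> 0" for x
      using tneg b0 by (simp add: mult_le_0_iff)
    then show False using nontriv i pathe by auto
  qed
  have cases: "(\<forall>i<L. a $ e i = M) \<and> (\<forall>D\<in>tight_bonds V E a b. single D) \<or>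
     b - M < M \<and> (\<forall>i<L. i \<noteq> k0 \<longrightarrow> a $ e i = b - M)"
  proof (cases "\<exists>D\<in>tight_bonds V E a b. \<not> single D")
    case False
    then have "a $ e i = M" if "i < L" for i
      using ex_tight[OF that] single_one(3) that by blast
    then show ?thesis using False by blast
  next
    case True
    then obtain D where D: "D \<in> tight_bonds V E a b" "\<not> single D" by blast
    then obtain j k where jk: "j < k" "k < L" "D = {e j, e k}"
        and "\<forall>i l. i < l \<longrightarrow> l < L \<longrightarrow> a $ e i + a $ e l \<le> b"
      using double[of D] by (auto simp: tight_bonds_def)
    then have pair: "a $ e i + a $ e l \<le> b" if "i \<noteq> l" "i < L" "l < L" for i l
      using that by (metis add.commute linorder_neqE_nat)
    have "D \<inter> path_edges P = {e j, e k}" using jk pathe by auto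
    \<comment> \<open>The tight bond \<open>D\<close> rules out the second alternative of the
      hypothesis, so the coefficients on the path are not all equal.\<close>
    then have "card (D \<inter> path_edges P) = 2" using jk e_eq_iff[of j k] by simp
    then obtain f g where "f \<in> path_edges P" "g \<in> path_edges P" "a $ f \<noteq> a $ g"
      using assms(8) D by blast
    then obtain f where "f \<in> path_edges P" "a $ f \<noteq> M" by metis
    then obtain i1 where i1: "i1 < L" "a $ e i1 < M" using M_ge pathe by force
    \<comment> \<open>A tight bond through \<open>e i\<close> is a pair of path edges with sum
      \<open>b\<close>; the partner is at most \<open>M\<close>, so
      \<open>a $ e i \<ge> b - M\<close>. The pair with \<open>e k0\<close> gives the reverse
      bound.\<close>
    have small: "a $ e i = b - M" if i: "i < L" "a $ e i < M" for i
    proof -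
      obtain D' where D': "D' \<in> tight_bonds V E a b" "e i \<in> D'" using ex_tight i by blast
      have "\<not> single D'" using single_one(3)[OF D'(1) _ i(1) D'(2)] i by auto
      then obtain m n where mn: "m < n" "n < L" "D' = {e m, e n}"
        using double[of D'] D' by (auto simp: tight_bonds_def)
      have "a $ e m + a $ e n = b"
        using D' mn e_eq_iff[of m n] by (simp add: tight_bonds_def inner_incidence_vector)
      moreover have "i = m \<or> i = n" using D' mn e_eq_iff[of i] i by auto
      moreover have "a $ e m \<le> M" "a $ e n \<le> M" using M_ge mn by auto
      moreover have "a $ e i + M \<le> b" using pair[of i k0] i k0 by auto
      ultimately show ?thesis by auto
    qed
    \<comment> \<open>A second edge of coefficient \<open>M\<close> would give
      \<open>2 * M \<le> b\<close> with \<open>e k0\<close>, contradicting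
      \<open>b - M < M\<close>.\<close>
    have "a $ e i = b - M" if "i < L" "i \<noteq> k0" for i
      using small[OF that(1)] pair[of i k0] M_ge[OF that(1)] that k0 small[OF i1] i1 by argo
    then show ?thesis using small[OF i1] i1 by auto
  qed

  \<comment> \<open>Uniqueness of the equation on the reduced graph\<close>
  have ab0: "abar \<noteq> 0"
  proof
    assume z: "abar = 0"
    then have M0: "M = 0" by (simp add: M_def)
    from cases show False
    proof
      assume A: "(\<forall>i<L. a $ e i = M) \<and> (\<forall>D\<in>tight_bonds V E a b. single D)"
      have "a $ f = 0" for f
      proof (cases "f \<in> E")
        case True
        then consider "f \<in> F" | i where "i < L" "f = e i" by (auto simp: F_def pathe)
        then show ?thesis using A M0 abF z by cases auto
      qed (use aE in \<open>auto simp: edge_space_def\<close>)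
      then show False using a0 by (simp add: vec_eq_iff)
    next
      \<comment> \<open>With \<open>M = 0\<close> this says \<open>b < 0\<close>, which the empty
        bond refutes.\<close>
      assume "b - M < M \<and> (\<forall>i<L. i \<noteq> k0 \<longrightarrow> a $ e i = b - M)"
      then show False
        using valid[OF empty_in_bonds[OF con]] M0 by (simp add: inner_incidence_vector)
    qed
  qed
  have "\<exists>t. cbar = t *\<^sub>R abar \<and> d = t * b"
    if cE: "cbar \<in> edge_space Ebar"
      and cd: "\<And>D. D \<in> tight_bonds Vbar Ebar abar b \<Longrightarrow> cbar \<bullet> incidence_vector D = d" for cbar d
  proof -
    \<comment> \<open>If some tight bond contains two edges \<open>e k0\<close> and \<open>e i\<close> of the path, their new coefficients
      must add up to \<open>d\<close>; otherwise all edges of the path inherit the coefficient of \<open>p\<close>.\<close>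
    define h where "h f = (if a $ f = M then cbar $ p else d - cbar $ p)" for f
    define c :: "real ^ ('a set)" where
      "c = (\<chi> f. if f \<in> F then cbar $ f else if f \<in> E then h f else 0)"
    have c_F: "c $ f = cbar $ f" if "f \<in> F" for f using that by (simp add: c_def)
    have c_e: "c $ e i = h (e i)" if "i < L" for i
      using that e_notin_F[OF that] PE pathe by (auto simp: c_def)
    have cE': "c \<in> edge_space E" by (auto simp: edge_space_def c_def F_def)
    have tight: "c \<bullet> incidence_vector D = d" if D: "D \<in> tight_bonds V E a b" for D
    proof (cases "single D")
      case s: True
      show ?thesis
      proof (cases "\<exists>i<L. e i \<in> D")
        case True
        then obtain i where i: "i < L" "e i \<in> D" by blast
        note so = single_one[OF D s i]
        have "c \<bullet> incidence_vector (D \<inter> F \<union> {e i}) = cbar \<bullet> incidence_vector (D \<inter> F \<union> {p})"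
          using inc_F[OF e_notin_F[OF i(1)], of c D] inc_F[OF pF, of cbar D] c_F c_e[OF i(1)] so(3)
          by (simp add: h_def)
        then show ?thesis unfolding so(2)[symmetric] cd[OF so(1)] .
      next
        case False
        then have D': "D \<in> tight_bonds Vbar Ebar abar b" "D \<subseteq> F" using single_none[OF D] by auto
        have "c \<bullet> incidence_vector D = cbar \<bullet> incidence_vector D"
          unfolding inner_incidence_vector using D'(2) c_F by (intro sum.cong) auto
        then show ?thesis using cd[OF D'(1)] by simp
      qed
    next
      case False
      then have B: "b - M < M" "\<And>i. i < L \<Longrightarrow> i \<noteq> k0 \<Longrightarrow> a $ e i = b - M"
        using cases D by blast+
      obtain j k where jk: "j < k" "k < L" "D = {e j, e k}"
        using double[of D] D False by (auto simp: tight_bonds_def)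
      have ne: "e j \<noteq> e k" using jk e_eq_iff[of j k] by simp
      have "a $ e j + a $ e k = b"
        using D jk ne by (simp add: tight_bonds_def inner_incidence_vector)
      \<comment> \<open>Two edges of coefficient \<open>b - M\<close> would sum to \<open>b\<close>
        only if \<open>b = 2 * M\<close>.\<close>
      then have "j = k0 \<or> k = k0" using B(1) B(2)[of j] B(2)[of k] jk by force
      then have "h (e j) + h (e k) = d"
      proof
        assume "j = k0"
        then show ?thesis using B(1) B(2)[of k] jk k0 by (simp add: h_def)
      next
        assume "k = k0"
        then show ?thesis using B(1) B(2)[of j] jk k0 by (simp add: h_def)
      qed
      then show ?thesis
        using jk ne c_e[of j] c_e[of k] by (simp add: inner_incidence_vector)
    qed
    obtain t where t: "c = t *\<^sub>R a" "d = t * b" using uniq[OF cE' tight] by blast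
    have "cbar $ f = t * abar $ f" for f
    proof -
      consider "f \<in> F" | "f = p" | "f \<notin> Ebar" using Ebar_eq by auto
      then show ?thesis
      proof cases
        case 1
        then show ?thesis using c_F[OF 1] abF[OF 1] t by simp
      next
        case 2
        \<comment> \<open>The coefficient of \<open>p\<close> is read off at \<open>e k0\<close>,
          where \<open>a\<close> takes the value \<open>M\<close>.\<close>
        have "cbar $ p = c $ e k0" using c_e k0 by (simp add: h_def)
        then show ?thesis using 2 t k0 by (simp add: M_def)
      next
        case 3
        then show ?thesis using cE abarE by (simp add: edge_space_def)
      qed
    qed
    then have "cbar = t *\<^sub>R abar" by (simp add: vec_eq_iff)
    then show ?thesis using t by blast
  qed
  then show ?thesis
    unfolding facet_defining_bond_polytope_iff[OF Gbar conb abarE]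
    using validb ab0 by (intro conjI ballI allI impI) auto
qed

end
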